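(* A Sturmian word $w$ over $\{a,b\}$ is non-quasiperiodic if and only if $w$ is an infinite Lyndon word over $\{a \prec b\}$ or over $\{b \prec a\}$.
   Context: Words are over the alphabet $\{a,b\}$; $|u|_a$ is the number of occurrences of $a$ in $u$. A word is balanced if $||u|_a-|v|_a|\le 1$ for any two of its factors $u,v$ of the same length. An infinite (i.e. right-infinite) word is ultimately periodic if it equals $uv^\omega$ for finite words $u$ and $v\neq\varepsilon$. A Sturmian word is an infinite balanced word over $\{a,b\}$ that is not ultimately periodic. An infinite word $w$ is quasiperiodic if there exist a finite word $u$ (a quasiperiod of $w$) and finite words $(p_n)_{n\ge 0}$ with $p_0=\varepsilon$ such that, for all $n\ge 0$, $0<|p_{n+1}|-|p_n|\le |u|$ and $p_nu$ is a prefix of $w$. It is non-quasiperiodic otherwise. $\{a\prec b\}$ denotes the alphabet $\{a,b\}$ with the total order $a\prec b$ (similarly $\{b\prec a\}$); the order is extended to words lexicographically. An infinite word $w'$ is a proper suffix of an infinite word $w$ if $w=uw'$ for some finite word $u\ne\varepsilon$. An infinite word is an infinite Lyndon word (for the given order) if it is strictly smaller, in the lexicographic order, than all its proper suffixes. *)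

theory Defs
  imports Main "HOL-Library.Omega_Words_Fun"
begin

datatype letter = A | B

definition factor :: "'a list \<Rightarrow> 'a word \<Rightarrow> bool" where
  "factor u w \<longleftrightarrow> (\<exists>p s. w = p \<frown> u \<frown> s)"

definition word_prefix :: "'a list \<Rightarrow> 'a word \<Rightarrow> bool" where
  "word_prefix u w \<longleftrightarrow> (\<exists>s. w = u \<frown> s)"

definition proper_suffix :: "'a word \<Rightarrow> 'a word \<Rightarrow> bool" where
  "proper_suffix w' w \<longleftrightarrow> (\<exists>u. u \<noteq> [] \<and> w = u \<frown> w')"

definition balanced :: "letter word \<Rightarrow> bool" where
  "balanced w \<longleftrightarrow> (\<forall>u v. factor u w \<and> factor v w \<and> length u = length v \<longrightarrow>
     \<bar>int (count_list u A) - int (count_list v A)\<bar> \<le> 1)"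

definition ultimately_periodic :: "'a word \<Rightarrow> bool" where
  "ultimately_periodic w \<longleftrightarrow> (\<exists>u v. v \<noteq> [] \<and> w = u \<frown> v\<^sup>\<omega>)"

definition sturmian :: "letter word \<Rightarrow> bool" where
  "sturmian w \<longleftrightarrow> balanced w \<and> \<not> ultimately_periodic w"

text \<open>The strict growth of the lengths forces \<open>u \<noteq> []\<close>.\<close>

definition quasiperiod :: "'a list \<Rightarrow> 'a word \<Rightarrow> bool" where
  "quasiperiod u w \<longleftrightarrow> (\<exists>p :: nat \<Rightarrow> 'a list. p 0 = [] \<and>
     (\<forall>n. 0 < int (length (p (Suc n))) - int (length (p n)) \<and>
          int (length (p (Suc n))) - int (length (p n)) \<le> int (length u) \<and>
          word_prefix (p n @ u) w))"

definition quasiperiodic :: "'a word \<Rightarrow> bool" where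
  "quasiperiodic w \<longleftrightarrow> (\<exists>u. quasiperiod u w)"

definition less_ab :: "letter \<Rightarrow> letter \<Rightarrow> bool" where
  "less_ab x y \<longleftrightarrow> x = A \<and> y = B"

definition less_ba :: "letter \<Rightarrow> letter \<Rightarrow> bool" where
  "less_ba x y \<longleftrightarrow> x = B \<and> y = A"

text \<open>Strict lexicographic order on infinite words for a strict order \<open>prec\<close> on the alphabet.
  The library's \<open>less_fun\<close> is tied to a fixed \<open>linorder\<close> instance, whereas two opposite orders
  on the same alphabet are needed here.\<close>

definition lex_less :: "('a \<Rightarrow> 'a \<Rightarrow> bool) \<Rightarrow> 'a word \<Rightarrow> 'a word \<Rightarrow> bool" where
  "lex_less prec x y \<longleftrightarrow> (\<exists>k. (\<forall>i<k. x i = y i) \<and> prec (x k) (y k))"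

definition infinite_lyndon :: "('a \<Rightarrow> 'a \<Rightarrow> bool) \<Rightarrow> 'a word \<Rightarrow> bool" where
  "infinite_lyndon prec w \<longleftrightarrow> (\<forall>w'. proper_suffix w' w \<longrightarrow> lex_less prec w w')"

end

theory Submission
  imports Defs
begin

text \<open>
  An infinite word is quasiperiodic iff occurrences of some fixed prefix cover all positions.
  If \<open>w\<close> is Lyndon and covered by \<open>u\<close>, take a later occurrence of \<open>u\<close> at \<open>k\<close>: the occurrence
  covering the first mismatch of \<open>w\<close> with its suffix at \<open>k\<close> exhibits a suffix smaller than \<open>w\<close>.

  Conversely, let the Sturmian word \<open>w\<close> start with \<open>c\<close> and have a suffix whose first mismatch with
  \<open>w\<close>, at \<open>d\<close>, carries \<open>c\<close> in the suffix; quasiperiodicity follows by induction on \<open>d\<close>. By balance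
  some letter \<open>y\<close> is isolated. If \<open>w\<close> starts with \<open>xy\<close>, a word \<open>xyx\<dots>x\<close> covers it. Otherwise \<open>w\<close> is
  the image, under \<open>x \<mapsto> x, y \<mapsto> xy\<close> or \<open>x \<mapsto> x, y \<mapsto> yx\<close>, of a Sturmian word with the same first
  letter and an earlier mismatch, and the image of a quasiperiodic word is quasiperiodic.
\<close>

section \<open>Positional characterisations\<close>

lemma factor_iff: "factor u w \<longleftrightarrow> (\<exists>i. u = w [i \<rightarrow> i + length u])"
proof
  assume "factor u w"
  then obtain p s where w: "w = p \<frown> u \<frown> s"
    unfolding factor_def by blast
  have "u = w [length p \<rightarrow> length p + length u]"
    unfolding w by (rule nth_equalityI) (auto simp: nth_append)
  then show "\<exists>i. u = w [i \<rightarrow> i + length u]" ..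
next
  assume "\<exists>i. u = w [i \<rightarrow> i + length u]"
  then obtain i where u: "u = w [i \<rightarrow> i + length u]" ..
  have "w = prefix i w \<frown> (w [i \<rightarrow> i + length u]) \<frown> suffix (i + length u) w"
    by (metis le_add1 prefix_suffix suffix_subseq_join)
  then show "factor u w"
    unfolding factor_def using u by metis
qed

lemma word_prefix_append_iff:
  assumes "word_prefix u w"
  shows "word_prefix (p @ u) w \<longleftrightarrow>
    p = prefix (length p) w \<and> (\<forall>j<length u. w (length p + j) = w j)"
proof -
  obtain s where w: "w = u \<frown> s"
    using assms unfolding word_prefix_def by blast
  have u: "u ! j = w j" if "j < length u" for j
    using that by (simp add: w)
  show ?thesis
  proof
    assume "word_prefix (p @ u) w"
    then obtain t where t: "w = (p @ u) \<frown> t"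
      unfolding word_prefix_def by blast
    have "p = prefix (length p) w"
      unfolding t by (rule nth_equalityI) (auto simp: nth_append)
    moreover have "w (length p + j) = w j" if "j < length u" for j
    proof -
      have "w (length p + j) = u ! j"
        unfolding t using that by (simp add: nth_append)
      then show ?thesis using u that by simp
    qed
    ultimately show "p = prefix (length p) w \<and> (\<forall>j<length u. w (length p + j) = w j)"
      by blast
  next
    assume *: "p = prefix (length p) w \<and> (\<forall>j<length u. w (length p + j) = w j)"
    have "p @ u = prefix (length p + length u) w"
    proof (rule nth_equalityI)
      fix i assume i: "i < length (p @ u)"
      show "(p @ u) ! i = prefix (length p + length u) w ! i"
      proof (cases "i < length p")
        case True
        then have "p ! i = w i"
          using * by (metis add_0 diff_zero subsequence_nth)
        then show ?thesis using i True by (simp add: nth_append)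
      next
        case False
        then show ?thesis using i * u[of "i - length p"]
          by (auto simp: nth_append dest!: spec[of _ "i - length p"])
      qed
    qed simp
    then show "word_prefix (p @ u) w"
      unfolding word_prefix_def by (metis prefix_suffix)
  qed
qed

text \<open>\<open>L\<close> is the length of the quasiperiod: occurrences that begin at 0 and start
  at most \<open>L\<close> apart leave no position uncovered.\<close>

lemma quasiperiodic_iff_cover:
  "quasiperiodic w \<longleftrightarrow> (\<exists>L. \<forall>m. \<exists>i\<le>m. m < i + L \<and> (\<forall>j<L. w (i + j) = w j))"
proof
  assume "quasiperiodic w"
  then obtain u p where p0: "p 0 = []"
    and p: "\<And>n. 0 < int (length (p (Suc n))) - int (length (p n)) \<and>
      int (length (p (Suc n))) - int (length (p n)) \<le> int (length u) \<and> word_prefix (p n @ u) w"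
    unfolding quasiperiodic_def quasiperiod_def by blast
  have step: "length (p n) < length (p (Suc n))" "length (p (Suc n)) \<le> length (p n) + length u" for n
    using p[of n] by linarith+
  have pref: "word_prefix (p n @ u) w" for n
    using p by blast
  have "word_prefix u w"
    using pref[of 0] p0 by simp
  then have occ: "w (length (p n) + j) = w j" if "j < length u" for n j
    using pref word_prefix_append_iff that by blast
  have "\<exists>i\<le>m. m < i + length u \<and> (\<forall>j<length u. w (i + j) = w j)" for m
  proof -
    have "\<exists>n. length (p n) \<le> m \<and> m < length (p (Suc n))"
    proof (induction m)
      case 0
      have "length (p 0) \<le> 0 \<and> 0 < length (p (Suc 0))"
        using p0 step(1)[of 0] by simp
      then show ?case by blast
    next
      case (Suc m)
      then obtain n where n: "length (p n) \<le> m" "m < length (p (Suc n))" by blast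
      show ?case
      proof (cases "Suc m < length (p (Suc n))")
        case True
        then show ?thesis using n by (intro exI[of _ n]) simp
      next
        case False
        then show ?thesis using n step(1)[of "Suc n"] by (intro exI[of _ "Suc n"]) simp
      qed
    qed
    then obtain n where "length (p n) \<le> m" "m < length (p n) + length u"
      using step(2) order.strict_trans2 by blast
    then show ?thesis using occ by blast
  qed
  then show "\<exists>L. \<forall>m. \<exists>i\<le>m. m < i + L \<and> (\<forall>j<L. w (i + j) = w j)" by blast
next
  assume "\<exists>L. \<forall>m. \<exists>i\<le>m. m < i + L \<and> (\<forall>j<L. w (i + j) = w j)"
  then obtain L where L: "\<And>m. \<exists>i\<le>m. m < i + L \<and> (\<forall>j<L. w (i + j) = w j)" by blast
  \<comment> \<open>\<open>q\<close> enumerates starts of successive occurrences: the one covering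
    position \<open>q n + L\<close> starts after \<open>q n\<close> and at most \<open>L\<close>
    later.\<close>
  define q where "q = rec_nat 0 (\<lambda>_ i. SOME i'. i' \<le> i + L \<and> i < i' \<and> (\<forall>j<L. w (i' + j) = w j))"
  have q0: "q 0 = 0" by (simp add: q_def)
  have q: "q (Suc n) \<le> q n + L \<and> q n < q (Suc n) \<and> (\<forall>j<L. w (q (Suc n) + j) = w j)" for n
  proof -
    have "\<exists>i'. i' \<le> q n + L \<and> q n < i' \<and> (\<forall>j<L. w (i' + j) = w j)"
      using L[of "q n + L"] by (metis add_less_cancel_right)
    from someI_ex[OF this] show ?thesis by (simp add: q_def)
  qed
  have occ: "\<forall>j<L. w (q n + j) = w j" for n
    using q q0 by (cases n) auto
  have "word_prefix (prefix L w) w"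
    unfolding word_prefix_def by (metis prefix_suffix)
  then have "word_prefix (prefix (q n) w @ prefix L w) w" for n
    using occ by (subst word_prefix_append_iff) auto
  moreover have "prefix (q 0) w = []" using q0 by simp
  moreover have "0 < int (length (prefix (q (Suc n)) w)) - int (length (prefix (q n) w))
     \<and> int (length (prefix (q (Suc n)) w)) - int (length (prefix (q n) w)) \<le> int (length (prefix L w))" for n
    using q[of n] by simp
  ultimately show "quasiperiodic w"
    unfolding quasiperiodic_def quasiperiod_def
    by (intro exI[of _ "prefix L w"] exI[of _ "\<lambda>n. prefix (q n) w"]) blast
qed

lemma ultimately_periodic_iff_shift:
  "ultimately_periodic w \<longleftrightarrow> (\<exists>N p. p > 0 \<and> (\<forall>n\<ge>N. w (n + p) = w n))"
proof
  assume "ultimately_periodic w"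
  then obtain u v where v: "v \<noteq> []" and w: "w = u \<frown> v\<^sup>\<omega>"
    unfolding ultimately_periodic_def by blast
  have "w (n + length v) = w n" if "n \<ge> length u" for n
  proof -
    have "n + length v - length u = (n - length u) + length v" using that by simp
    then have "(n + length v - length u) mod length v = (n - length u) mod length v"
      by (metis mod_add_self2)
    then show ?thesis using that v by (simp add: w)
  qed
  then show "\<exists>N p. p > 0 \<and> (\<forall>n\<ge>N. w (n + p) = w n)" using v by blast
next
  assume "\<exists>N p. p > 0 \<and> (\<forall>n\<ge>N. w (n + p) = w n)"
  then obtain N p where p: "p > 0" and per: "\<And>n. n \<ge> N \<Longrightarrow> w (n + p) = w n" by blast
  have mult: "w (N + r + k * p) = w (N + r)" for r k
  proof (induction k)
    case (Suc k)
    then show ?case using per[of "N + r + k * p"] by (simp add: algebra_simps)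
  qed simp
  have "suffix N w = (w [N \<rightarrow> N + p])\<^sup>\<omega>"
  proof
    fix n
    show "suffix N w n = (w [N \<rightarrow> N + p])\<^sup>\<omega> n"
      using mult[of "n mod p" "n div p"] p by (simp add: add.assoc)
  qed
  then have "w = prefix N w \<frown> (w [N \<rightarrow> N + p])\<^sup>\<omega>"
    by (metis prefix_suffix)
  moreover have "w [N \<rightarrow> N + p] \<noteq> []" using p by simp
  ultimately show "ultimately_periodic w"
    unfolding ultimately_periodic_def by blast
qed

lemma proper_suffix_iff: "proper_suffix w' w \<longleftrightarrow> (\<exists>k>0. w' = suffix k w)"
proof
  assume "proper_suffix w' w"
  then obtain u where "u \<noteq> []" "w = u \<frown> w'"
    unfolding proper_suffix_def by blast
  then show "\<exists>k>0. w' = suffix k w"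
    by (intro exI[of _ "length u"]) simp
next
  assume "\<exists>k>0. w' = suffix k w"
  then obtain k where "k > 0" "w' = suffix k w" by blast
  then show "proper_suffix w' w"
    unfolding proper_suffix_def by (intro exI[of _ "prefix k w"]) simp
qed

section \<open>Balance in terms of letter counts of prefixes\<close>

primrec letter_count :: "'a \<Rightarrow> 'a word \<Rightarrow> nat \<Rightarrow> nat" where
  "letter_count y w 0 = 0"
| "letter_count y w (Suc n) = letter_count y w n + (if w n = y then 1 else 0)"

lemma letter_count_add:
  "letter_count y w (i + n) = letter_count y w i + count_list (w [i \<rightarrow> i + n]) y"
  by (induction n) auto

lemma letter_count_mono: "i \<le> j \<Longrightarrow> letter_count y w i \<le> letter_count y w j"
  using letter_count_add[of y w i "j - i"] by simp

lemma count_list_A_B: "count_list u A + count_list u B = length u"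
proof (induction u)
  case (Cons a u)
  then show ?case by (cases a) auto
qed simp

text \<open>Either letter may serve as \<open>y\<close>, as the two counts of a factor add up to its
  length. Swapping \<open>i\<close> and \<open>j\<close> replaces the absolute value, and sums avoid
  truncated subtraction.\<close>

lemma balanced_iff_letter_count:
  "balanced w \<longleftrightarrow> (\<forall>i j n. letter_count y w (i + n) + letter_count y w j
     \<le> letter_count y w (j + n) + letter_count y w i + 1)" (is "_ \<longleftrightarrow> ?R")
proof -
  have "balanced w \<longleftrightarrow> (\<forall>i j n.
     \<bar>int (count_list (w [i \<rightarrow> i + n]) A) - int (count_list (w [j \<rightarrow> j + n]) A)\<bar> \<le> 1)"
  proof
    show "balanced w \<Longrightarrow> \<forall>i j n.
     \<bar>int (count_list (w [i \<rightarrow> i + n]) A) - int (count_list (w [j \<rightarrow> j + n]) A)\<bar> \<le> 1"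
      unfolding balanced_def factor_iff by (metis add_diff_cancel_left' subsequence_length)
    show "\<forall>i j n. \<bar>int (count_list (w [i \<rightarrow> i + n]) A) - int (count_list (w [j \<rightarrow> j + n]) A)\<bar> \<le> 1
      \<Longrightarrow> balanced w"
      unfolding balanced_def factor_iff by metis
  qed
  also have "\<dots> \<longleftrightarrow> (\<forall>i j n.
     \<bar>int (count_list (w [i \<rightarrow> i + n]) y) - int (count_list (w [j \<rightarrow> j + n]) y)\<bar> \<le> 1)"
  proof (cases y)
    case B
    have "\<bar>int (count_list (w [i \<rightarrow> i + n]) A) - int (count_list (w [j \<rightarrow> j + n]) A)\<bar>
      = \<bar>int (count_list (w [i \<rightarrow> i + n]) B) - int (count_list (w [j \<rightarrow> j + n]) B)\<bar>" for i j n
      using count_list_A_B[of "w [i \<rightarrow> i + n]"] count_list_A_B[of "w [j \<rightarrow> j + n]"] by simp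
    then show ?thesis using B by simp
  qed simp
  also have "\<dots> \<longleftrightarrow> (\<forall>i j n. count_list (w [i \<rightarrow> i + n]) y \<le> count_list (w [j \<rightarrow> j + n]) y + 1)"
  proof
    assume *: "\<forall>i j n. \<bar>int (count_list (w [i \<rightarrow> i + n]) y) - int (count_list (w [j \<rightarrow> j + n]) y)\<bar> \<le> 1"
    show "\<forall>i j n. count_list (w [i \<rightarrow> i + n]) y \<le> count_list (w [j \<rightarrow> j + n]) y + 1"
    proof (intro allI)
      fix i j n
      show "count_list (w [i \<rightarrow> i + n]) y \<le> count_list (w [j \<rightarrow> j + n]) y + 1"
        using *[rule_format, of i n j] by linarith
    qed
  next
    assume *: "\<forall>i j n. count_list (w [i \<rightarrow> i + n]) y \<le> count_list (w [j \<rightarrow> j + n]) y + 1"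
    show "\<forall>i j n. \<bar>int (count_list (w [i \<rightarrow> i + n]) y) - int (count_list (w [j \<rightarrow> j + n]) y)\<bar> \<le> 1"
    proof (intro allI)
      fix i j n
      show "\<bar>int (count_list (w [i \<rightarrow> i + n]) y) - int (count_list (w [j \<rightarrow> j + n]) y)\<bar> \<le> 1"
        using *[rule_format, of i n j] *[rule_format, of j n i] by linarith
    qed
  qed
  also have "\<dots> \<longleftrightarrow> ?R" by (simp add: letter_count_add)
  finally show ?thesis .
qed

lemma letter_eq_iff:
  fixes a b y :: letter
  shows "a = b \<longleftrightarrow> (a = y \<longleftrightarrow> b = y)"
  by (cases a; cases b; cases y) auto

section \<open>Infinite Lyndon words are not quasiperiodic\<close>

lemma infinite_lyndon_not_quasiperiodic:
  assumes lyn: "infinite_lyndon prec w"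
    and asym: "\<And>x y. prec x y \<Longrightarrow> \<not> prec y x"
  shows "\<not> quasiperiodic w"
proof
  assume "quasiperiodic w"
  then obtain L where L: "\<And>m. \<exists>i\<le>m. m < i + L \<and> (\<forall>j<L. w (i + j) = w j)"
    unfolding quasiperiodic_iff_cover by blast
  have less: "\<exists>d. (\<forall>i<d. w i = w (k + i)) \<and> prec (w d) (w (k + d))" if "k > 0" for k
  proof -
    have "lex_less prec w (suffix k w)"
      using lyn that unfolding infinite_lyndon_def proper_suffix_iff by blast
    then show ?thesis unfolding lex_less_def by simp
  qed
  \<comment> \<open>Minimality forces every positive occurrence of the prefix of length
    \<open>L\<close> to start at \<open>k\<close> or later.\<close>
  define k where "k = (LEAST k. k > 0 \<and> (\<forall>j<L. w (k + j) = w j))"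
  \<comment> \<open>An occurrence covering position \<open>L\<close> cannot start at 0.\<close>
  have "\<exists>k. k > 0 \<and> (\<forall>j<L. w (k + j) = w j)"
    using L[of L] by (metis add_0 gr_zeroI less_irrefl)
  then have k: "k > 0" "\<forall>j<L. w (k + j) = w j"
    using LeastI_ex[of "\<lambda>k. k > 0 \<and> (\<forall>j<L. w (k + j) = w j)"] unfolding k_def by auto
  have k_least: "k \<le> i" if "i > 0" "\<forall>j<L. w (i + j) = w j" for i
    unfolding k_def using that by (intro Least_le) simp
  obtain d where d: "\<And>i. i < d \<Longrightarrow> w i = w (k + i)" "prec (w d) (w (k + d))"
    using less[OF k(1)] by blast
  have irr: "\<not> prec x x" for x using asym by blast
  have "d \<ge> L" using k(2) d(2) irr by (metis linorder_not_less)
  \<comment> \<open>The occurrence of the quasiperiod covering the mismatch starts after \<open>k\<close>; shifted back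
    by \<open>k\<close>, it gives a suffix that is smaller than \<open>w\<close>.\<close>
  obtain i where i: "i \<le> k + d" "k + d < i + L" "\<forall>j<L. w (i + j) = w j"
    using L by blast
  have "i > 0" using i(2) \<open>d \<ge> L\<close> by simp
  then have "k \<le> i" using k_least i(3) by blast
  define t where "t = i - k"
  have it: "i = k + t" using \<open>k \<le> i\<close> by (simp add: t_def)
  define r where "r = d - t"
  have td: "d = t + r" using i(1) it by (simp add: r_def)
  have rL: "r < L" using i(2) it td by simp
  have "w (k + d) = w r" using i(3) rL by (simp add: it td add.assoc)
  have "t \<noteq> 0"
    using d(2) irr \<open>w (k + d) = w r\<close> td by (metis add_0)
  obtain d' where d': "\<And>i. i < d' \<Longrightarrow> w i = w (t + i)" "prec (w d') (w (t + d'))"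
    using less[of t] \<open>t \<noteq> 0\<close> by blast
  have agree: "w (t + j) = w j" if "j < r" for j
    using d(1)[of "t + j"] i(3) that rL by (simp add: it td add.assoc)
  \<comment> \<open>The suffix at \<open>t\<close> agrees with \<open>w\<close> before
    \<open>r\<close> and carries the smaller letter at \<open>r\<close>, so \<open>d'\<close> can be
    neither below, above nor equal to \<open>r\<close>.\<close>
  have "\<not> d' < r" using d'(2) agree irr by metis
  moreover have gt: "prec (w (t + r)) (w r)"
    using d(2) \<open>w (k + d) = w r\<close> td by simp
  moreover have "\<not> r < d'" using d'(1)[of r] gt irr by auto
  ultimately show False using d'(2) asym by (metis linorder_neqE_nat)
qed

section \<open>Desubstitution\<close>

text \<open>
  If \<open>y\<close> is isolated in \<open>w\<close> and \<open>x\<close> is the other letter, then \<open>w\<close> is a concatenation of blocks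
  \<open>x\<close> and \<open>xy\<close> if it starts with \<open>x\<close> (\<open>e = 1\<close>), and of blocks \<open>x\<close> and \<open>yx\<close> if it starts with
  \<open>y\<close> (\<open>e = 0\<close>); \<open>pos n\<close> is the start of the \<open>n\<close>-th block and \<open>v\<close> is the desubstituted word.
\<close>

locale isolated_letter =
  fixes w :: "letter word" and y :: letter
  assumes isolated: "w i = y \<Longrightarrow> w (Suc i) \<noteq> y"
begin

text \<open>Offset at which a two-letter block carries its \<open>y\<close>; the letter there tells
  a block \<open>x\<close> from a longer one.\<close>

definition e :: nat where
  "e = (if w 0 = y then 0 else 1)"

primrec pos :: "nat \<Rightarrow> nat" where
  "pos 0 = 0"
| "pos (Suc n) = pos n + (if w (pos n + e) = y then 2 else 1)"

definition v :: "letter word" where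
  "v n = w (pos n + e)"

lemma pos_Suc: "pos (Suc n) = pos n + (if v n = y then 2 else 1)"
  by (simp add: v_def)

lemma starts_x: "w (pos n) \<noteq> y" if "w 0 \<noteq> y"
proof (induction n)
  case (Suc n)
  then show ?case using isolated[of "Suc (pos n)"] that by (auto simp: e_def)
qed (use that in simp)

lemma strict_mono_pos: "strict_mono pos"
  by (rule strict_mono_Suc_iff[THEN iffD2]) (auto simp: pos_Suc)

lemma pos_ge: "n \<le> pos n"
  using strict_mono_pos by (rule strict_mono_imp_increasing)

lemma pos_cover: "\<exists>n. pos n \<le> m \<and> m < pos (Suc n)"
proof (induction m)
  case (Suc m)
  then obtain n where n: "pos n \<le> m" "m < pos (Suc n)" by blast
  have "pos (Suc n) < pos (Suc (Suc n))" by (auto simp: pos_Suc[of "Suc n"] simp del: pos.simps)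
  then show ?case
    using n by (cases "Suc m < pos (Suc n)") (auto intro: exI[of _ n] exI[of _ "Suc n"] simp del: pos.simps)
qed (auto intro: exI[of _ 0])

lemma letter_count_pos: "letter_count y w (pos n) = letter_count y v n"
proof (induction n)
  case (Suc n)
  show ?case
  proof (cases "w 0 = y")
    case True
    then show ?thesis using Suc isolated[of "pos n"]
      by (auto simp: pos_Suc v_def e_def simp del: pos.simps(2))
  next
    case False
    then show ?thesis using Suc starts_x[of n]
      by (auto simp: pos_Suc v_def e_def simp del: pos.simps(2))
  qed
qed simp

lemma pos_eq: "pos n = n + letter_count y v n"
  by (induction n) (auto simp: pos_Suc simp del: pos.simps(2))

lemma v_0: "v 0 = w e"
  by (simp add: v_def)

text \<open>A position that starts no block holds the second letter of \<open>xy\<close> or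
  \<open>yx\<close>, which differs from \<open>w 0\<close>.\<close>

lemma block_start_if: "\<exists>n. k = pos n" if "w k = w 0"
proof -
  obtain n where n: "pos n \<le> k" "k < pos (Suc n)" using pos_cover by blast
  then consider "k = pos n" | "k = Suc (pos n)" "v n = y"
    by (auto simp: pos_Suc less_Suc_eq split: if_splits simp del: pos.simps(2))
  then show ?thesis
  proof cases
    case 2
    then show ?thesis using that isolated[of "pos n"] by (auto simp: v_def e_def split: if_splits)
  qed blast
qed

lemma block_cong:
  assumes "v n = v n'" "i < pos (Suc n) - pos n"
  shows "w (pos n + i) = w (pos n' + i)"
proof -
  have "i < (if v n = y then 2 else 1)" using assms(2) by (simp add: pos_Suc del: pos.simps(2))
  then consider "i = 0" | "i = 1" "v n = y" by (cases "v n = y") (auto simp: less_2_cases_iff)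
  then show ?thesis
  proof cases
    case 1
    then show ?thesis using assms(1) starts_x[of n] starts_x[of n'] letter_eq_iff[of "w (pos n)" "w (pos n')" y]
      by (auto simp: v_def e_def split: if_splits)
  next
    case 2
    then show ?thesis using assms(1) isolated[of "pos n"] isolated[of "pos n'"]
      letter_eq_iff[of "w (pos n + 1)" "w (pos n' + 1)" y]
      by (auto simp: v_def e_def split: if_splits)
  qed
qed

text \<open>In terms of the substitution, equal factors of \<open>v\<close> have equal images. This
  carries occurrences and periods over to \<open>w\<close>.\<close>

lemma image_cong:
  assumes "\<And>i. i < j \<Longrightarrow> v (n + i) = v (n' + i)"
  shows "pos (n + j) - pos n = pos (n' + j) - pos n'
    \<and> (\<forall>i < pos (n + j) - pos n. w (pos n + i) = w (pos n' + i))"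
  using assms
proof (induction j)
  case (Suc j)
  have le: "pos n \<le> pos (n + j)" "pos n' \<le> pos (n' + j)"
    using strict_mono_pos by (auto simp: strict_mono_less_eq)
  have IH: "pos (n + j) - pos n = pos (n' + j) - pos n'"
    "\<And>i. i < pos (n + j) - pos n \<Longrightarrow> w (pos n + i) = w (pos n' + i)"
    using Suc by auto
  define D where "D = pos (n + j) - pos n"
  have D: "pos (n + j) = pos n + D" "pos (n' + j) = pos n' + D"
    using le IH(1) by (simp_all add: D_def)
  have eq: "v (n + j) = v (n' + j)" using Suc.prems by simp
  have "w (pos n + i) = w (pos n' + i)" if i: "i < pos (n + Suc j) - pos n" for i
  proof (cases "i < pos (n + j) - pos n")
    case False
    define r where "r = i - D"
    have r: "i = D + r" using False D by (simp add: r_def)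
    have "pos (Suc (n + j)) = pos n + D + (pos (Suc (n + j)) - pos (n + j))"
      using D by (simp add: pos_Suc del: pos.simps)
    then have "r < pos (Suc (n + j)) - pos (n + j)" using i r by (simp del: pos.simps)
    from block_cong[OF eq this] show ?thesis
      using D r by (simp add: add.assoc)
  qed (use IH in blast)
  moreover have "pos (n + Suc j) - pos n = pos (n' + Suc j) - pos n'"
    using D eq by (simp add: pos_Suc del: pos.simps)
  ultimately show ?case by blast
qed simp

section \<open>Transfer of properties between \<open>v\<close> and \<open>w\<close>\<close>

lemma quasiperiodic_image:
  assumes "quasiperiodic v"
  shows "quasiperiodic w"
proof -
  obtain L where L: "\<And>m. \<exists>i\<le>m. m < i + L \<and> (\<forall>j<L. v (i + j) = v j)"
    using assms unfolding quasiperiodic_iff_cover by blast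
  have "\<exists>i\<le>m. m < i + pos L \<and> (\<forall>j<pos L. w (i + j) = w j)" for m
  proof -
    obtain n where n: "pos n \<le> m" "m < pos (Suc n)" using pos_cover by blast
    obtain i where i: "i \<le> n" "n < i + L" "\<forall>j<L. v (i + j) = v j" using L by blast
    have "pos i \<le> pos n" "pos (Suc n) \<le> pos (i + L)" "pos i \<le> pos (i + L)"
      using i by (simp_all add: strict_mono_less_eq[OF strict_mono_pos] del: pos.simps)
    moreover have "pos (i + L) - pos i = pos L"
      "\<forall>j<pos (i + L) - pos i. w (pos i + j) = w j"
      using image_cong[of L i 0] i(3) by simp_all
    ultimately show ?thesis using n by (intro exI[of _ "pos i"]) (auto simp del: pos.simps)
  qed
  then show ?thesis unfolding quasiperiodic_iff_cover by blast
qed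

lemma ultimately_periodic_image:
  assumes "ultimately_periodic v"
  shows "ultimately_periodic w"
proof -
  obtain N p where p: "p > 0" and per: "\<And>n. n \<ge> N \<Longrightarrow> v (n + p) = v n"
    using assms unfolding ultimately_periodic_iff_shift by blast
  define P where "P = pos (N + p) - pos N"
  have P: "pos N < pos (N + p)" using p by (simp add: strict_mono_less[OF strict_mono_pos])
  have "w (m + P) = w m" if m: "m \<ge> pos N" for m
  proof -
    \<comment> \<open>Blocks are nonempty, so \<open>Suc m\<close> blocks from \<open>N\<close> on
      reach past \<open>m\<close>.\<close>
    have "m < pos (N + Suc m)" using pos_ge[of "N + Suc m"] by simp
    then have "m - pos N < pos (N + Suc m) - pos N" using m by (simp del: pos.simps)
    then have "w (pos N + (m - pos N)) = w (pos (N + p) + (m - pos N))"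
      using image_cong[of "Suc m" N "N + p"] per by (metis add.commute add.left_commute le_add1)
    then show ?thesis using m P by (simp add: P_def add.commute)
  qed
  then show ?thesis
    unfolding ultimately_periodic_iff_shift using P by (intro exI[of _ "pos N"] exI[of _ P]) (simp add: P_def)
qed

text \<open>If two equally long factors of \<open>v\<close> have \<open>y\<close>-counts differing
  by 2, so do their images, and the lengths of the images differ by 2 as well. Taking an
  \<open>x\<close> off the longer image and adding a neighbouring \<open>x\<close> to the shorter
  one gives an imbalance in \<open>w\<close>.\<close>

lemma balanced_preimage:
  assumes "balanced w" "v 0 = w 0"
  shows "balanced v"
proof (rule ccontr)
  let ?c = "letter_count y v"
  let ?C = "letter_count y w"
  let ?bad = "\<lambda>n. \<exists>i j. ?c (i + n) + ?c j \<ge> ?c (j + n) + ?c i + 2"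
  assume "\<not> balanced v"
  then have ex: "\<exists>n. ?bad n"
    unfolding balanced_iff_letter_count[of v y]
    by (simp add: not_le less_eq_Suc_le) blast
  define n where "n = (LEAST n. ?bad n)"
  have "?bad n" unfolding n_def using ex by (rule LeastI_ex)
  then obtain i j where ij: "?c (i + n) + ?c j \<ge> ?c (j + n) + ?c i + 2" by blast
  have least: "\<not> ?bad m" if "m < n" for m
    using that unfolding n_def by (rule not_less_Least)
  obtain m where m: "n = Suc m" using ij by (cases n) auto
  \<comment> \<open>Minimality: dropping the last letters makes the excess exactly \<open>2\<close>, dropping the first ones
    gives \<open>v j \<noteq> y\<close>, so that \<open>j\<close> is not the initial position when \<open>w\<close> starts with \<open>y\<close>.\<close>
  have "\<not> ?c (i + m) + ?c j \<ge> ?c (j + m) + ?c i + 2" using least[of m] m by blast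
  then have exact: "?c (i + n) + ?c j = ?c (j + n) + ?c i + 2"
    using ij m by (auto split: if_splits)
  have "\<not> ?c (Suc i + m) + ?c (Suc j) \<ge> ?c (Suc j + m) + ?c (Suc i) + 2" using least[of m] m by blast
  then have vj: "v j \<noteq> y" using ij m by (auto split: if_splits)
  have bal: "?C (a + l) + ?C b \<le> ?C (b + l) + ?C a + 1" for a b l
    using assms(1) unfolding balanced_iff_letter_count[of w y] by blast
  have lt: "pos i < pos (i + n)" "pos j < pos (j + n)"
    using m by (simp_all add: strict_mono_less[OF strict_mono_pos] del: pos.simps)
  \<comment> \<open>The image at \<open>i\<close> has length \<open>l + 1\<close>, the one at
    \<open>j\<close> length \<open>l - 1\<close>; both are adjusted to length
    \<open>l\<close>.\<close>
  define l where "l = pos (i + n) - pos i - 1"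
  have l1: "pos (i + n) = pos i + l + 1" using lt by (simp add: l_def)
  have l2: "pos (j + n) + 1 = pos j + l"
    using exact l1 pos_eq[of "i + n"] pos_eq[of i] pos_eq[of "j + n"] pos_eq[of j] by linarith
  have Cp: "?C (pos (i + n)) + ?C (pos j) = ?C (pos (j + n)) + ?C (pos i) + 2"
    using exact by (simp add: letter_count_pos del: pos.simps)
  show False
  proof (cases "w 0 = y")
    case False
    \<comment> \<open>Blocks start with \<open>x\<close>: drop the first letter of the longer image
      and append the letter following the shorter one.\<close>
    have "?C (Suc (pos i)) = ?C (pos i)" "?C (Suc (pos (j + n))) = ?C (pos (j + n))"
      using starts_x[OF False] by simp_all
    moreover have "?C (Suc (pos i) + l) = ?C (pos (i + n))" "?C (pos j + l) = ?C (Suc (pos (j + n)))"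
      using l1 l2 by (simp_all del: letter_count.simps)
    ultimately show False using bal[of "Suc (pos i)" l "pos j"] Cp by linarith
  next
    case True
    \<comment> \<open>Blocks end with \<open>x\<close>: drop the last letter of the longer image and
      prepend the letter preceding the shorter one, which needs \<open>j > 0\<close>.\<close>
    then obtain j' where j': "j = Suc j'" using vj assms(2) by (cases j) auto
    have last: "?C (pos (Suc k) - 1) = ?C (pos (Suc k))" for k
      using isolated[of "pos k"] True by (simp add: e_def)
    have "?C (pos i + l) = ?C (pos (i + n))" using last[of "i + m"] m l1 by (simp del: pos.simps)
    moreover have "?C (pos j - 1) = ?C (pos j)" using last j' by (simp del: pos.simps)
    moreover have "pos j - 1 + l = pos (j + n)"
      using l2 pos_ge[of j] j' by (simp del: pos.simps)
    ultimately show False using bal[of "pos i" l "pos j - 1"] Cp by simp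
  qed
qed

text \<open>As \<open>w k = w 0\<close>, the suffix at \<open>k\<close> starts at a block boundary
  and desubstitutes to a suffix of \<open>v\<close>. The first mismatch of that suffix with
  \<open>v\<close>, at \<open>d'\<close>, shows up in \<open>w\<close> at
  \<open>pos d' + e\<close>.\<close>

lemma mismatch_preimage:
  assumes nup: "\<not> ultimately_periodic w" and v0: "v 0 = w 0"
    and k: "k > 0" and eq: "\<And>i. i < d \<Longrightarrow> w (k + i) = w i"
    and d: "w (k + d) = w 0" "w d \<noteq> w 0"
  shows "\<exists>k' d'. k' > 0 \<and> d' < d \<and> (\<forall>i<d'. v (k' + i) = v i) \<and> v (k' + d') = v 0 \<and> v d' \<noteq> v 0"
proof -
  have "d > 0" using d by (cases d) auto
  then have wk: "w k = w 0" using eq[of 0] by simp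
  then obtain k' where k': "k = pos k'" using block_start_if by blast
  have "k' > 0" using k k' by (cases k') auto
  have "\<exists>i. v (k' + i) \<noteq> v i"
  proof (rule ccontr)
    assume "\<nexists>i. v (k' + i) \<noteq> v i"
    then have "v (i + k') = v i" for i by (simp add: add.commute)
    then have "ultimately_periodic v"
      unfolding ultimately_periodic_iff_shift using \<open>k' > 0\<close> by blast
    then show False using nup ultimately_periodic_image by blast
  qed
  define d' where "d' = (LEAST i. v (k' + i) \<noteq> v i)"
  have neq: "v (k' + d') \<noteq> v d'"
    unfolding d'_def using \<open>\<exists>i. v (k' + i) \<noteq> v i\<close> by (rule LeastI_ex)
  have eq': "v (k' + i) = v i" if "i < d'" for i
    using not_less_Least[of i "\<lambda>i. v (k' + i) \<noteq> v i"] that unfolding d'_def by blast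
  have "pos k' \<le> pos (k' + d')" by (simp add: strict_mono_less_eq[OF strict_mono_pos])
  then have pd: "pos (k' + d') = k + pos d'" and agree: "\<And>i. i < pos d' \<Longrightarrow> w (k + i) = w i"
    using image_cong[of d' k' 0] eq' k' by auto
  have "w (k + (pos d' + e)) \<noteq> w (pos d' + e)"
    using neq pd by (simp add: v_def add.assoc)
  then have "d \<le> pos d' + e" using eq by (metis linorder_not_less)
  moreover have "pos d' \<le> d" using agree d by (metis linorder_not_less)
  \<comment> \<open>For \<open>e = 0\<close> the two bounds coincide; for \<open>e = 1\<close> both
    words have \<open>x\<close> at offset \<open>pos d'\<close>, so the mismatch comes one letter
    later.\<close>
  ultimately have dd: "d = pos d' + e"
  proof (cases "w 0 = y")
    case False
    have "w (k + pos d') = w (pos d')"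
      using starts_x[OF False, of d'] starts_x[OF False, of "k' + d'"] pd
        letter_eq_iff[of "w (k + pos d')" "w (pos d')" y] by simp
    then have "d \<noteq> pos d'" using d by metis
    then show ?thesis
      using \<open>d \<le> pos d' + e\<close> \<open>pos d' \<le> d\<close> False by (simp add: e_def)
  qed (simp add: e_def)
  have "d' < d"
  proof (cases "w 0 = y")
    case False
    then show ?thesis using dd pos_ge[of d'] by (simp add: e_def)
  next
    case True
    \<comment> \<open>Since \<open>d' > 0\<close>, the two-letter block at index 0 precedes the
      mismatch and pushes \<open>pos d'\<close> beyond \<open>d'\<close>.\<close>
    have "v k' = v 0" using wk k' True by (simp add: v_def e_def)
    then have "Suc 0 \<le> d'" using neq by (cases d') auto
    then have "letter_count y v (Suc 0) \<le> letter_count y v d'" by (rule letter_count_mono)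
    moreover have "letter_count y v (Suc 0) = 1" using v0 True by simp
    ultimately have "d' < pos d'" using pos_eq[of d'] by linarith
    then show ?thesis using dd by simp
  qed
  moreover have "v (k' + d') = v 0" "v d' \<noteq> v 0"
    using d dd pd v0 by (simp_all add: v_def add.assoc)
  ultimately show ?thesis using \<open>k' > 0\<close> eq' by blast
qed

text \<open>The gaps between consecutive \<open>y\<close>s are \<open>g\<close> or \<open>g + 1\<close>, so \<open>x y x\<^sup>g\<^sup>-\<^sup>1\<close> covers \<open>w\<close>.\<close>

lemma quasiperiodic_if_y_second:
  assumes bal: "balanced w" and nup: "\<not> ultimately_periodic w" and w1: "w 1 = y"
  shows "quasiperiodic w"
proof -
  have w0: "w 0 \<noteq> y" using isolated[of 0] w1 by auto
  have before: "w p \<noteq> y" if "w (Suc p) = y" for p using isolated that by blast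
  let ?gap = "\<lambda>g. g > 0 \<and> (\<exists>p. w p = y \<and> w (p + g) = y)"
  have ex: "\<exists>g. ?gap g"
  proof (rule ccontr)
    assume "\<nexists>g. ?gap g"
    then have no: "w (1 + g) \<noteq> y" if "g > 0" for g
      using that w1 by blast
    have "w n \<noteq> y" if "n \<ge> 2" for n
      using no[of "n - 1"] that by simp
    then have "w (n + 1) = w n" if "n \<ge> 2" for n
      using that letter_eq_iff[of "w (n + 1)" "w n" y] by auto
    then show False using nup unfolding ultimately_periodic_iff_shift by blast
  qed
  \<comment> \<open>The least distance between two occurrences of \<open>y\<close>; one exists, as
    otherwise \<open>w\<close> would end in \<open>x\<close> repeated forever.\<close>
  define g where "g = (LEAST g. ?gap g)"
  have "?gap g" unfolding g_def using ex by (rule LeastI_ex)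
  then obtain p0 where g: "g > 0" "w p0 = y" "w (p0 + g) = y" by blast
  have least: "w (p + j) \<noteq> y" if "w p = y" "0 < j" "j < g" for p j
    using not_less_Least[of j ?gap] that unfolding g_def by blast
  \<comment> \<open>The factor of length \<open>g + 1\<close> at \<open>p0\<close> contains two
    \<open>y\<close>s, so by balance no factor of that length is free of \<open>y\<close>.\<close>
  have gap_le: "\<exists>j>0. j \<le> g + 1 \<and> w (p + j) = y" for p
  proof (rule ccontr)
    assume no: "\<not> ?thesis"
    have "letter_count y w (Suc p + j) = letter_count y w (Suc p)" if "j \<le> g + 1" for j
      using that
    proof (induction j)
      case (Suc j)
      then show ?case using no by (auto dest: spec[of _ "Suc j"])
    qed simp
    then have "letter_count y w (Suc p + (g + 1)) = letter_count y w (Suc p)" by blast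
    moreover have "letter_count y w (p0 + (g + 1)) \<ge> letter_count y w p0 + 2"
      using g letter_count_mono[of "Suc p0" "p0 + g" y w] by simp
    moreover have "letter_count y w (p0 + (g + 1)) + letter_count y w (Suc p)
      \<le> letter_count y w (Suc p + (g + 1)) + letter_count y w p0 + 1"
      using bal unfolding balanced_iff_letter_count[of w y] by blast
    ultimately show False by linarith
  qed
  have "\<exists>i\<le>m. m < i + (g + 1) \<and> (\<forall>j<g + 1. w (i + j) = w j)" for m
  proof -
    \<comment> \<open>As \<open>w\<close> starts with \<open>xy\<close>, the occurrence covering
      \<open>m\<close> starts one letter before the last \<open>y\<close> among the positions up to
      \<open>m + 1\<close>.\<close>
    define p where "p = (GREATEST p. p \<le> Suc m \<and> w p = y)"
    have "p \<le> Suc m \<and> w p = y"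
      unfolding p_def by (rule GreatestI_nat[of _ 1 "Suc m"]) (use w1 in auto)
    then have p: "p \<le> Suc m" "w p = y" by auto
    have p_greatest: "q \<le> p" if "q \<le> Suc m" "w q = y" for q
      unfolding p_def by (rule Greatest_le_nat[of _ _ "Suc m"]) (use that in auto)
    obtain i where i: "p = Suc i" using p w0 by (cases p) auto
    obtain j where j: "j > 0" "j \<le> g + 1" "w (p + j) = y" using gap_le by blast
    have "Suc m < p + j" using p_greatest[of "p + j"] j by (meson leI less_add_same_cancel1 not_less)
    then have "m < i + (g + 1)" using j i by simp
    moreover have "w (i + j) = w j" if "j < g + 1" for j
    proof -
      consider "j = 0" | "j = 1" | "j > 1" by linarith
      then have "w (i + j) = y \<longleftrightarrow> w j = y"
      proof cases
        case 1
        then show ?thesis using before[of i] i p w0 by simp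
      next
        case 2
        then show ?thesis using i p w1 by simp
      next
        case 3
        then have "w (p + (j - 1)) \<noteq> y" "w (1 + (j - 1)) \<noteq> y"
          using least[OF p(2), of "j - 1"] least[OF w1, of "j - 1"] that by linarith+
        then show ?thesis using 3 i by simp
      qed
      then show ?thesis using letter_eq_iff by blast
    qed
    ultimately show ?thesis using i p by (intro exI[of _ i]) auto
  qed
  then show ?thesis unfolding quasiperiodic_iff_cover by blast
qed

end

section \<open>The descent\<close>

text \<open>Otherwise both \<open>AA\<close> and \<open>BB\<close> occur, and their counts of
  \<open>A\<close> differ by 2.\<close>

lemma balanced_isolated_letter:
  assumes "balanced w"
  obtains y where "isolated_letter w y"
proof -
  have "isolated_letter w A \<or> isolated_letter w B"
  proof (rule ccontr)
    assume "\<not> ?thesis"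
    then obtain i j where "w i = A" "w (Suc i) = A" "w j = B" "w (Suc j) = B"
      unfolding isolated_letter_def by blast
    moreover have "letter_count A w (i + 2) + letter_count A w j
        \<le> letter_count A w (j + 2) + letter_count A w i + 1"
      using assms unfolding balanced_iff_letter_count[of w A] by blast
    ultimately show False by (simp add: numeral_2_eq_2)
  qed
  then show thesis using that by blast
qed

lemma quasiperiodic_if_smaller_suffix:
  assumes "sturmian w" "k > 0" "\<And>i. i < d \<Longrightarrow> w (k + i) = w i"
    and "w (k + d) = w 0" "w d \<noteq> w 0"
  shows "quasiperiodic w"
  using assms
proof (induction d arbitrary: w k rule: less_induct)
  case (less d)
  have bal: "balanced w" and nup: "\<not> ultimately_periodic w"
    using less.prems(1) unfolding sturmian_def by auto
  obtain y where "isolated_letter w y" using balanced_isolated_letter[OF bal] .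
  then interpret isolated_letter w y .
  show ?case
  proof (cases "w 1 = y")
    case True
    then show ?thesis using quasiperiodic_if_y_second bal nup by blast
  next
    case False
    \<comment> \<open>If \<open>w 0 = y\<close>, then \<open>e = 0\<close> and \<open>v 0\<close> is
      \<open>w 0\<close> itself; otherwise \<open>v 0 = w 1\<close>, and neither \<open>w 0\<close>
      nor \<open>w 1\<close> is \<open>y\<close>.\<close>
    then have v0: "v 0 = w 0"
      using letter_eq_iff[of "w 1" "w 0" y] by (auto simp: v_0 e_def)
    obtain k' d' where "k' > 0" "d' < d" "\<forall>i<d'. v (k' + i) = v i" "v (k' + d') = v 0" "v d' \<noteq> v 0"
      using mismatch_preimage[OF nup v0 less.prems(2-5)] by blast
    moreover have "sturmian v"
      using balanced_preimage[OF bal v0] ultimately_periodic_image nup unfolding sturmian_def by blast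
    ultimately have "quasiperiodic v" using less.IH by blast
    then show ?thesis by (rule quasiperiodic_image)
  qed
qed

lemma infinite_lyndon_if_not_quasiperiodic:
  assumes stu: "sturmian w" and nq: "\<not> quasiperiodic w"
    and prec: "\<And>z. z \<noteq> w 0 \<Longrightarrow> prec (w 0) z"
  shows "infinite_lyndon prec w"
  unfolding infinite_lyndon_def proper_suffix_iff
proof (intro allI impI, elim exE conjE)
  fix w' k
  assume k: "k > 0" and w': "w' = suffix k w"
  have ex: "\<exists>i. w (k + i) \<noteq> w i"
  proof (rule ccontr)
    assume "\<nexists>i. w (k + i) \<noteq> w i"
    then have "w (i + k) = w i" for i by (simp add: add.commute)
    then have "ultimately_periodic w"
      unfolding ultimately_periodic_iff_shift using k by blast
    then show False using stu unfolding sturmian_def by blast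
  qed
  define d where "d = (LEAST i. w (k + i) \<noteq> w i)"
  have neq: "w (k + d) \<noteq> w d" unfolding d_def using ex by (rule LeastI_ex)
  have eq: "w (k + i) = w i" if "i < d" for i
    using not_less_Least[of i "\<lambda>i. w (k + i) \<noteq> w i"] that unfolding d_def by blast
  \<comment> \<open>Otherwise the suffix carries the minimal letter \<open>w 0\<close> at the
    mismatch, which makes \<open>w\<close> quasiperiodic.\<close>
  have "w d = w 0"
  proof (rule ccontr)
    assume "w d \<noteq> w 0"
    moreover from this have "w (k + d) = w 0" using neq letter_eq_iff[of "w (k + d)" "w d" "w 0"] by blast
    ultimately show False using quasiperiodic_if_smaller_suffix[OF stu k eq] nq by blast
  qed
  then have "prec (w d) (w (k + d))" using prec neq by metis
  then show "lex_less prec w w'"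
    unfolding lex_less_def w' using eq by (intro exI[of _ d]) simp
qed

theorem theorem6p5:
  fixes w :: "letter word"
  assumes "sturmian w"
  shows "\<not> quasiperiodic w \<longleftrightarrow> infinite_lyndon less_ab w \<or> infinite_lyndon less_ba w"
proof
  assume nq: "\<not> quasiperiodic w"
  show "infinite_lyndon less_ab w \<or> infinite_lyndon less_ba w"
  \<comment> \<open>The order is chosen so that the first letter of \<open>w\<close> is
    minimal.\<close>
  proof (cases "w 0")
    case A
    then have "less_ab (w 0) z" if "z \<noteq> w 0" for z
      using that by (cases z) (auto simp: less_ab_def)
    then show ?thesis using infinite_lyndon_if_not_quasiperiodic[OF assms nq] by blast
  next
    case B
    then have "less_ba (w 0) z" if "z \<noteq> w 0" for z
      using that by (cases z) (auto simp: less_ba_def)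
    then show ?thesis using infinite_lyndon_if_not_quasiperiodic[OF assms nq] by blast
  qed
next
  assume "infinite_lyndon less_ab w \<or> infinite_lyndon less_ba w"
  then show "\<not> quasiperiodic w"
    using infinite_lyndon_not_quasiperiodic[of less_ab w] infinite_lyndon_not_quasiperiodic[of less_ba w]
    by (auto simp: less_ab_def less_ba_def)
qed

end
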